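(* Let $\Delta=\{1/n^2 : n=1,2,\dots\}$ and, for $p\in\Delta$, let $\nu_p$ be a random variable with values in $\mathbb{N}=\{1,2,\dots\}$ whose probability generating function is $$\mathcal{P}_p(z)=\mathbf{E}\left[z^{\nu_p}\right]=\frac{1}{T_{1/\sqrt{p}}(1/z)},$$ where $T_n$ is the Chebyshev polynomial of degree $n$. Then: (i) $\mathcal{P}_{p_1}\circ\mathcal{P}_{p_2}=\mathcal{P}_{p_2}\circ\mathcal{P}_{p_1}$ for all $p_1,p_2\in\Delta$, i.e. the semigroup generated under composition by $\{\mathcal{P}_p : p\in\Delta\}$ is commutative. (ii) The function $\varphi(t)=1/\cosh(\sqrt{2t})$, $t\ge 0$, satisfies $\varphi(t)=\mathcal{P}_p(\varphi(pt))$ for all $p\in\Delta$, together with the initial conditions $\varphi(0)=1$, $\varphi'(0)=-1$. (iii) For every $a>0$, the function $f(t)=\dfrac{1}{\cosh(at)}$, $t\in\mathbb{R}$ (the characteristic function of the hyperbolic secant distribution with scale parameter $a$), is the characteristic function of a strictly $\nu$-normal random variable for the family $\{\nu_p : p\in\Delta\}$.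
   Context: The Chebyshev polynomial $T_n$ is determined by $T_n(\cos\zeta)=\cos(n\zeta)$. For each $n\ge 1$ the function $1/T_n(1/z)$ (set equal to $0$ at $z=0$) is the probability generating function of a random variable with values in $\mathbb{N}=\{1,2,\dots\}$, so the variables $\nu_p$ exist. The derivative $\varphi'(0)$ is the right derivative at $0$. Strictly $\nu$-normal: given a family $\{\nu_p : p\in\Delta\}$ of $\mathbb{N}$-valued random variables with $\mathbf{E}[\nu_p]=1/p$, a random variable $X$ is called strictly $\nu$-normal if $\mathbf{E}X=0$, $\mathbf{E}X^2<\infty$, and for every $p\in\Delta$ $$X\overset{d}{=}p^{1/2}\sum_{j=1}^{\nu_p}X_j,$$ where $X_1,X_2,\dots$ are i.i.d. copies of $X$ independent of $\nu_p$, and $\overset{d}{=}$ denotes equality in distribution. *)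

theory Defs
  imports "HOL-Probability.Probability" "HOL-Computational_Algebra.Polynomial"
begin

definition cheb_poly :: "nat \<Rightarrow> real poly" where
  "cheb_poly n = (THE P. \<forall>\<zeta>. poly P (cos \<zeta>) = cos (real n * \<zeta>))"

lemma cheb_poly_ex1: "\<exists>!P :: real poly. \<forall>\<zeta>. poly P (cos \<zeta>) = cos (real n * \<zeta>)"
proof (rule ex_ex1I)
  show "\<exists>P :: real poly. \<forall>\<zeta>. poly P (cos \<zeta>) = cos (real n * \<zeta>)"
  proof (induction n rule: less_induct)
    case (less n)
    consider "n = 0" | "n = 1" | m where "n = Suc (Suc m)"
      by (metis One_nat_def nat.exhaust)
    then show ?case
    proof cases
      case 1
      then show ?thesis by (intro exI[of _ 1]) simp
    next
      case 2
      then show ?thesis by (intro exI[of _ "[:0, 1:]"]) simp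
    next
      case 3
      obtain P :: "real poly" where P: "\<And>\<zeta>. poly P (cos \<zeta>) = cos (real m * \<zeta>)"
        using less.IH[of m] 3 by auto
      obtain Q :: "real poly" where Q: "\<And>\<zeta>. poly Q (cos \<zeta>) = cos (real (Suc m) * \<zeta>)"
        using less.IH[of "Suc m"] 3 by auto
      have "poly ([:0, 2:] * Q - P) (cos \<zeta>) = cos (real n * \<zeta>)" for \<zeta>
      proof -
        have "cos (real n * \<zeta>) = cos (real (Suc m) * \<zeta> + \<zeta>)"
          by (simp add: 3 algebra_simps)
        moreover have "cos (real m * \<zeta>) = cos (real (Suc m) * \<zeta> - \<zeta>)"
          by (simp add: algebra_simps)
        ultimately show ?thesis
          unfolding cos_add cos_diff poly_diff poly_mult P Q by simp
      qed
      then show ?thesis by blast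
    qed
  qed
next
  fix P Q :: "real poly"
  assume P: "\<forall>\<zeta>. poly P (cos \<zeta>) = cos (real n * \<zeta>)"
    and Q: "\<forall>\<zeta>. poly Q (cos \<zeta>) = cos (real n * \<zeta>)"
  have "{-1..1} \<subseteq> {x. poly (P - Q) x = 0}"
  proof
    fix x :: real assume "x \<in> {-1..1}"
    then have "cos (arccos x) = x" by simp
    then show "x \<in> {x. poly (P - Q) x = 0}"
      using P[rule_format, of "arccos x"] Q[rule_format, of "arccos x"] by simp
  qed
  moreover have "infinite {-1..1::real}" by (simp add: infinite_Icc)
  ultimately have "P - Q = 0" using poly_roots_finite finite_subset by blast
  then show "P = Q" by simp
qed

lemma poly_cheb_poly_cos: "poly (cheb_poly n) (cos \<zeta>) = cos (real n * \<zeta>)"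
  using theI'[OF cheb_poly_ex1[of n]] unfolding cheb_poly_def by blast

text \<open>
  The values of \<open>1 / T\<^sub>n(1/z)\<close> outside the closed unit disc play no role.
  The value at \<open>0\<close> is explicit because \<open>1 / 0 = 0\<close> in HOL would give \<open>1 / T\<^sub>n(0)\<close>.
\<close>

definition cheb_gf :: "nat \<Rightarrow> complex \<Rightarrow> complex" where
  "cheb_gf n z =
    (if z = 0 then 0 else 1 / poly (map_poly complex_of_real (cheb_poly n)) (1 / z))"

definition pgf :: "'a measure \<Rightarrow> ('a \<Rightarrow> nat) \<Rightarrow> complex \<Rightarrow> complex" where
  "pgf M K z = (\<integral>\<omega>. z ^ K \<omega> \<partial>M)"

inductive_set comp_semigroup :: "('a \<Rightarrow> 'a) set \<Rightarrow> ('a \<Rightarrow> 'a) set"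
  for S :: "('a \<Rightarrow> 'a) set" where
  gen: "F \<in> S \<Longrightarrow> F \<in> comp_semigroup S"
| comp: "F \<in> comp_semigroup S \<Longrightarrow> G \<in> comp_semigroup S \<Longrightarrow> F \<circ> G \<in> comp_semigroup S"

text \<open>
  The law of \<open>c * (X\<^sub>1 + \<dots> + X\<^sub>K)\<close>, where \<open>X\<^sub>1, X\<^sub>2, \<dots>\<close> are i.i.d. with
  law \<open>\<mu>\<close> and independent of \<open>K\<close>, which has law \<open>\<kappa>\<close>; it is built from the coordinates of the
  canonical product space. The lemma below shows that every realisation of such variables,
  on any probability space, yields this law.
\<close>

definition random_sum_law :: "real \<Rightarrow> nat measure \<Rightarrow> real measure \<Rightarrow> real measure" where
  "random_sum_law c \<kappa> \<mu> =
    distr (\<kappa> \<Otimes>\<^sub>M (\<Pi>\<^sub>M j\<in>{1::nat..}. \<mu>)) borel (\<lambda>(k, x). c * (\<Sum>j=1..k. x j))"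

lemma random_sum_measurable:
  "(\<lambda>(k, x). c * (\<Sum>j=1..k. x j))
    \<in> borel_measurable (count_space {1::nat..} \<Otimes>\<^sub>M (\<Pi>\<^sub>M j\<in>{1::nat..}. (borel :: real measure)))"
proof (rule measurable_pair_measure_countable1)
  show "countable {1::nat..}" by simp
  fix k :: nat
  have "(\<lambda>x. x j) \<in> borel_measurable (\<Pi>\<^sub>M j\<in>{1::nat..}. (borel :: real measure))"
    if "j \<in> {1..k}" for j
    using that by (intro measurable_component_singleton) auto
  then show "(\<lambda>y. case (k, y) of (k, x) \<Rightarrow> c * (\<Sum>j=1..k. x j))
      \<in> borel_measurable (\<Pi>\<^sub>M j\<in>{1::nat..}. (borel :: real measure))"
    unfolding prod.case by (intro borel_measurable_times borel_measurable_sum) auto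
qed

lemma distr_random_sum:
  fixes K :: "'s \<Rightarrow> nat" and Y :: "nat \<Rightarrow> 's \<Rightarrow> real"
  assumes "prob_space S"
    and law: "\<And>j. j \<ge> 1 \<Longrightarrow> distr S borel (Y j) = \<mu>"
    and iid: "prob_space.indep_vars S (\<lambda>_. borel) Y {1..}"
    and rvK: "K \<in> S \<rightarrow>\<^sub>M count_space {1..}"
    and indep: "prob_space.indep_set S
      (sets (vimage_algebra (space S) K (count_space {1..})))
      (sets (vimage_algebra (space S) (\<lambda>\<omega>. \<lambda>j\<in>{1..}. Y j \<omega>) (\<Pi>\<^sub>M j\<in>{1..}. borel)))"
  shows "distr S borel (\<lambda>\<omega>. c * (\<Sum>j=1..K \<omega>. Y j \<omega>)) =
    random_sum_law c (distr S (count_space {1..}) K) \<mu>"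
proof -
  interpret prob_space S by fact
  let ?C = "count_space {1::nat..}" and ?P = "\<Pi>\<^sub>M j\<in>{1::nat..}. (borel :: real measure)"
  let ?Y = "\<lambda>\<omega>. \<lambda>j\<in>{1..}. Y j \<omega>"
  let ?f = "\<lambda>(k::nat, x::nat \<Rightarrow> real). c * (\<Sum>j=1..k. x j)"
  have rv: "random_variable borel (Y i)" if "i \<in> {1..}" for i
    using iid that unfolding indep_vars_def by auto
  have "distr S ?P ?Y = (\<Pi>\<^sub>M j\<in>{1..}. distr S borel (Y j))"
    using iid by (subst (asm) indep_vars_iff_distr_eq_PiM') (auto intro: rv)
  also have "\<dots> = (\<Pi>\<^sub>M j\<in>{1..}. \<mu>)"
    by (intro PiM_cong) (auto simp: law)
  finally have PiM: "distr S ?P ?Y = (\<Pi>\<^sub>M j\<in>{1..}. \<mu>)" .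
  have rvY: "random_variable ?P ?Y"
    by (intro measurable_restrict rv) auto
  have KY: "(\<lambda>\<omega>. (K \<omega>, ?Y \<omega>)) \<in> S \<rightarrow>\<^sub>M ?C \<Otimes>\<^sub>M ?P"
    by (intro measurable_Pair rvK rvY)
  interpret DK: prob_space "distr S ?C K" by (rule prob_space_distr[OF rvK])
  interpret DY: prob_space "distr S ?P ?Y" by (rule prob_space_distr[OF rvY])
  have joint: "distr S ?C K \<Otimes>\<^sub>M distr S ?P ?Y = distr S (?C \<Otimes>\<^sub>M ?P) (\<lambda>\<omega>. (K \<omega>, ?Y \<omega>))"
  proof (rule pair_measure_eqI)
    show "sigma_finite_measure (distr S ?C K)" "sigma_finite_measure (distr S ?P ?Y)"
      by unfold_locales
    show "sets (distr S ?C K \<Otimes>\<^sub>M distr S ?P ?Y) = sets (distr S (?C \<Otimes>\<^sub>M ?P) (\<lambda>\<omega>. (K \<omega>, ?Y \<omega>)))"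
      unfolding sets_distr by (intro sets_pair_measure_cong) simp_all
    fix A B assume "A \<in> sets (distr S ?C K)" "B \<in> sets (distr S ?P ?Y)"
    then have A: "A \<in> sets ?C" and B: "B \<in> sets ?P" by simp_all
    have "prob ((K -` A \<inter> space S) \<inter> (?Y -` B \<inter> space S)) =
        prob (K -` A \<inter> space S) * prob (?Y -` B \<inter> space S)"
      using indep by (rule indep_setD) (intro in_vimage_algebra A B)+
    moreover have "(\<lambda>\<omega>. (K \<omega>, ?Y \<omega>)) -` (A \<times> B) \<inter> space S =
        (K -` A \<inter> space S) \<inter> (?Y -` B \<inter> space S)" by auto
    ultimately show "emeasure (distr S ?C K) A * emeasure (distr S ?P ?Y) B =
        emeasure (distr S (?C \<Otimes>\<^sub>M ?P) (\<lambda>\<omega>. (K \<omega>, ?Y \<omega>))) (A \<times> B)"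
      using A B rvK rvY KY
      by (simp add: emeasure_distr pair_measureI emeasure_eq_measure ennreal_mult'' del: vimage_Times)
  qed
  have "random_sum_law c (distr S ?C K) \<mu> =
      distr (distr S (?C \<Otimes>\<^sub>M ?P) (\<lambda>\<omega>. (K \<omega>, ?Y \<omega>))) borel ?f"
    unfolding random_sum_law_def PiM[symmetric] joint ..
  also have "\<dots> = distr S borel (?f \<circ> (\<lambda>\<omega>. (K \<omega>, ?Y \<omega>)))"
    by (intro distr_distr random_sum_measurable measurable_Pair rvK rvY)
  also have "?f \<circ> (\<lambda>\<omega>. (K \<omega>, ?Y \<omega>)) = (\<lambda>\<omega>. c * (\<Sum>j=1..K \<omega>. Y j \<omega>))"
    by (auto simp: fun_eq_iff intro!: arg_cong[where f = "(*) c"] sum.cong)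
  finally show ?thesis by simp
qed

text \<open>
  The member \<open>\<nu> p\<close> of the family lives on its own probability space \<open>N p\<close>. The requirement
  that it takes values in \<open>{1, 2, \<dots>}\<close> is the measurability into \<open>count_space {1..}\<close>.
\<close>

definition nu_family ::
  "real set \<Rightarrow> (real \<Rightarrow> 'a measure) \<Rightarrow> (real \<Rightarrow> 'a \<Rightarrow> nat) \<Rightarrow> bool" where
  "nu_family \<Delta> N \<nu> \<longleftrightarrow> (\<forall>p\<in>\<Delta>. prob_space (N p) \<and> \<nu> p \<in> N p \<rightarrow>\<^sub>M count_space {1..} \<and>
     integrable (N p) (\<lambda>\<omega>. real (\<nu> p \<omega>)) \<and> (\<integral>\<omega>. real (\<nu> p \<omega>) \<partial>N p) = 1 / p)"

definition strictly_nu_normal ::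
  "real set \<Rightarrow> (real \<Rightarrow> 'a measure) \<Rightarrow> (real \<Rightarrow> 'a \<Rightarrow> nat) \<Rightarrow> 'b measure \<Rightarrow> ('b \<Rightarrow> real) \<Rightarrow> bool"
  where
  "strictly_nu_normal \<Delta> N \<nu> M X \<longleftrightarrow>
     nu_family \<Delta> N \<nu> \<and>
     prob_space M \<and> X \<in> borel_measurable M \<and>
     integrable M X \<and> (\<integral>\<omega>. X \<omega> \<partial>M) = 0 \<and> integrable M (\<lambda>\<omega>. (X \<omega>)\<^sup>2) \<and>
     (\<forall>p\<in>\<Delta>. distr M borel X =
        random_sum_law (p powr (1/2)) (distr (N p) (count_space {1..}) (\<nu> p)) (distr M borel X))"

end

theory Submission
  imports Defs "HOL-Real_Asymp.Real_Asymp"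
begin

text \<open>
  In the coordinates \<open>z = 1 / cosh s\<close> the map \<open>1 / T\<^sub>n(1/z)\<close> is \<open>s \<mapsto> n s\<close>, whence commutativity,
  the functional equation, and \<open>E[\<nu>\<^sub>p] = lim (1 - P\<^sub>p(z)) / (1 - z) = n\<^sup>2\<close> as \<open>z\<close> increases to 1.

  The hyperbolic secant law is obtained without computing a Fourier integral, as a weak limit: the
  sum of \<open>\<nu>\<^sub>p\<close> independent random signs, scaled by \<open>a / n\<close> with \<open>p = 1 / n\<^sup>2\<close>, has characteristic
  function \<open>1 / T\<^sub>n(1 / cos (a t / n))\<close>, which tends to \<open>1 / cosh (a t)\<close>. These laws have second
  moment at most \<open>a\<^sup>2\<close>, so they are tight and Helly's theorem yields the limit law. It is a fixed
  point of the random summation because a law is determined by its characteristic function.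
\<close>

section \<open>Chebyshev polynomials at complex arguments and composition of the maps
  \<open>1 / T_n(1/z)\<close>\<close>

lemma cheb_poly_unique:
  assumes "\<And>\<zeta>. poly P (cos \<zeta>) = cos (real n * \<zeta>)"
  shows "cheb_poly n = P"
  using cheb_poly_ex1[of n] poly_cheb_poly_cos[of n] assms by blast

lemma cheb_poly_0: "cheb_poly 0 = 1"
  by (rule cheb_poly_unique) simp

lemma cheb_poly_1: "cheb_poly (Suc 0) = [:0, 1:]"
  by (rule cheb_poly_unique) simp

lemma cheb_poly_Suc_Suc:
  "cheb_poly (Suc (Suc n)) = smult 2 (pCons 0 (cheb_poly (Suc n))) - cheb_poly n"
proof (rule cheb_poly_unique)
  fix \<zeta> :: real
  have "cos (real (Suc (Suc n)) * \<zeta>) = cos (real (Suc n) * \<zeta> + \<zeta>)"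
    and "cos (real n * \<zeta>) = cos (real (Suc n) * \<zeta> - \<zeta>)"
    by (simp_all add: algebra_simps)
  then show "poly (smult 2 (pCons 0 (cheb_poly (Suc n))) - cheb_poly n) (cos \<zeta>) =
      cos (real (Suc (Suc n)) * \<zeta>)"
    unfolding poly_diff poly_smult poly_pCons poly_cheb_poly_cos by (simp add: cos_add cos_diff)
qed

lemma map_poly_of_real_diff:
  "map_poly complex_of_real (P - Q) = map_poly of_real P - map_poly of_real Q"
  by (intro poly_eqI) (simp add: coeff_map_poly)

text \<open>The defining identity speaks of real angles only. The three-term recurrence carries it
  to complex angles, which are needed because every \<open>1 / z\<close> is a complex cosine and
  \<open>cosh\<close> is the cosine on the imaginary axis.\<close>

lemma poly_cheb_poly_cos_complex:
  "poly (map_poly complex_of_real (cheb_poly n)) (cos \<zeta>) = cos (of_nat n * \<zeta>)"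
proof (induction n rule: induct_nat_012)
  case (ge2 n)
  have "cos (of_nat (Suc (Suc n)) * \<zeta>) = cos (of_nat (Suc n) * \<zeta> + \<zeta>)"
    and "cos (of_nat n * \<zeta>) = cos (of_nat (Suc n) * \<zeta> - \<zeta>)"
    by (simp_all add: algebra_simps)
  then show ?case
    unfolding cheb_poly_Suc_Suc map_poly_of_real_diff poly_diff
    by (simp add: ge2.IH map_poly_smult map_poly_pCons cos_add cos_diff)
qed (simp_all add: cheb_poly_0 cheb_poly_1 map_poly_pCons)

lemma cheb_gf_inverse_cos:
  assumes "cos \<zeta> \<noteq> 0"
  shows "cheb_gf n (1 / cos \<zeta>) = 1 / cos (of_nat n * \<zeta>)"
  using assms by (simp add: cheb_gf_def poly_cheb_poly_cos_complex)

text \<open>That is, all complex zeros of \<open>T\<^sub>n\<close> lie in the open unit disc.\<close>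

lemma cos_mult_nonzero:
  fixes \<zeta> :: complex
  assumes "norm (cos \<zeta>) \<ge> 1"
  shows "cos (of_nat n * \<zeta>) \<noteq> 0"
proof
  assume "cos (of_nat n * \<zeta>) = 0"
  then obtain k :: int where k: "of_nat n * \<zeta> = complex_of_real (k * pi) + of_real pi / 2"
    unfolding cos_eq_0 by blast
  have "n \<noteq> 0" using \<open>cos (of_nat n * \<zeta>) = 0\<close> by (cases n) auto
  define x where "x = (k * pi + pi / 2) / n"
  have \<zeta>: "\<zeta> = complex_of_real x"
    using k \<open>n \<noteq> 0\<close> by (simp add: x_def field_simps)
  have "\<bar>cos x\<bar> \<ge> 1"
    using assms unfolding \<zeta> cos_of_real norm_of_real .
  \<comment> \<open>A real \<open>x\<close> with \<open>|cos x| >= 1\<close> is a multiple of pi,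
    hence so is \<open>n * x\<close>; sine and cosine of \<open>n * x\<close> would then vanish
    together.\<close>
  then have "sin x = 0"
    using sin_cos_squared_add[of x] abs_le_square_iff[of 1 "cos x"]
    by (smt (verit) abs_one one_power2 zero_le_power2 zero_eq_power2)
  then obtain m :: int where m: "x = of_int m * pi" using sin_zero_iff_int2 by auto
  have "cos (real n * x) = 0"
    using \<open>cos (of_nat n * \<zeta>) = 0\<close> unfolding \<zeta>
    by (metis cos_of_real of_real_eq_0_iff of_real_mult of_real_of_nat_eq)
  moreover have "real n * x = of_int (int n * m) * pi" by (simp add: m)
  then have "sin (real n * x) = 0" using sin_zero_iff_int2 by blast
  ultimately show False using sin_cos_squared_add[of "real n * x"] by simp
qed

text \<open>With \<open>1 / z = cos \<zeta>\<close>, solvable by surjectivity of the complex cosine,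
  each map multiplies the angle by its index. In the closed disc \<open>T_n(1/z)\<close> is nonzero;
  otherwise \<open>1 / 0 = 0\<close> would make the inner value 0 and the composition law could
  fail.\<close>

lemma cheb_gf_comp:
  assumes "norm z \<le> 1"
  shows "cheb_gf m (cheb_gf n z) = cheb_gf (m * n) z"
proof (cases "z = 0")
  case True
  then show ?thesis by (simp add: cheb_gf_def)
next
  case False
  define \<zeta> where "\<zeta> = Arccos (1 / z)"
  have \<zeta>: "cos \<zeta> = 1 / z" by (simp add: \<zeta>_def)
  then have z: "z = 1 / cos \<zeta>" using False by simp
  have nz: "cos \<zeta> \<noteq> 0" using \<zeta> False by simp
  have "norm (cos \<zeta>) \<ge> 1" using assms False by (simp add: \<zeta> norm_divide)
  then have "cos (of_nat n * \<zeta>) \<noteq> 0" by (rule cos_mult_nonzero)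
  then show ?thesis unfolding z
    by (simp add: cheb_gf_inverse_cos nz mult.assoc)
qed

text \<open>The angle here is purely imaginary. This real form drives all limits and functional
  equations below.\<close>

lemma cheb_gf_inverse_cosh:
  "cheb_gf n (complex_of_real (1 / cosh s)) = complex_of_real (1 / cosh (real n * s))"
proof -
  have *: "cos (\<i> * complex_of_real x) = complex_of_real (cosh x)" for x
    by (simp add: cos_conv_cosh cosh_def scaleR_conv_of_real flip: exp_of_real of_real_minus)
  show ?thesis
    using cheb_gf_inverse_cos[of "\<i> * complex_of_real s" n] *[of s] *[of "real n * s"]
    by (simp add: mult.left_commute)
qed

section \<open>Characteristic functions of random sums\<close>

text \<open>The inner integral of the Fubini argument for random sums: for a fixed number of
  summands the coordinates are i.i.d., so characteristic functions multiply.\<close>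

lemma char_scaled_sum:
  assumes "real_distribution \<mu>"
  shows "(CLINT x|(\<Pi>\<^sub>M j\<in>{1::nat..}. \<mu>). iexp (t * (c * (\<Sum>j=1..k. x j)))) = char \<mu> (c * t) ^ k"
proof -
  interpret \<mu>: real_distribution \<mu> by fact
  let ?P = "\<Pi>\<^sub>M j\<in>{1::nat..}. \<mu>"
  interpret P: prob_space ?P by (intro prob_space_PiM) unfold_locales
  have comp: "distr ?P borel (\<lambda>x. x j) = \<mu>" if "j \<in> {1..}" for j
  proof -
    have "distr ?P borel (\<lambda>x. x j) = distr ?P \<mu> (\<lambda>x. x j)"
      by (rule distr_cong) simp_all
    also have "\<dots> = \<mu>"
      using that by (intro distr_PiM_component) (auto intro: \<mu>.prob_space_axioms)
    finally show ?thesis .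
  qed
  have meas: "(\<lambda>x. x j) \<in> borel_measurable ?P" if "j \<in> {1..}" for j
    using measurable_component_singleton[of j "{1..}" "\<lambda>_. \<mu>"] that by simp
  have "P.indep_vars (\<lambda>_. borel) (\<lambda>j x. x j) {1..}"
  proof (subst P.indep_vars_iff_distr_eq_PiM')
    \<comment> \<open>Points of the product space are already extensional on \<open>{1..}\<close>,
      so the restriction is the identity and the joint law is the product law itself.\<close>
    have "distr ?P (\<Pi>\<^sub>M j\<in>{1::nat..}. borel) (\<lambda>x. \<lambda>j\<in>{1..}. x j) = distr ?P ?P (\<lambda>x. x)"
      by (intro distr_cong) (auto simp: space_PiM intro!: sets_PiM_cong)
    also have "\<dots> = (\<Pi>\<^sub>M j\<in>{1..}. distr ?P borel (\<lambda>x. x j))"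
      unfolding distr_id2[OF refl] by (intro PiM_cong refl comp [symmetric])
    finally show "distr ?P (\<Pi>\<^sub>M j\<in>{1::nat..}. borel) (\<lambda>x. \<lambda>j\<in>{1..}. x j) =
        (\<Pi>\<^sub>M j\<in>{1..}. distr ?P borel (\<lambda>x. x j))" .
  qed (auto intro: meas)
  then have "P.indep_vars (\<lambda>_. borel) (\<lambda>j x. x j) {1..k}"
    by (rule P.indep_vars_subset) auto
  then have "char (distr ?P borel (\<lambda>x. \<Sum>j=1..k. x j)) (c * t) =
      (\<Prod>j=1..k. char (distr ?P borel (\<lambda>x. x j)) (c * t))"
    by (rule P.char_distr_sum)
  also have "\<dots> = char \<mu> (c * t) ^ k"
    by (subst prod.cong[OF refl arg_cong2[where f = char, OF comp refl]]) auto
  also have "char (distr ?P borel (\<lambda>x. \<Sum>j=1..k. x j)) (c * t) =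
      (CLINT x|?P. iexp (c * t * (\<Sum>j=1..k. x j)))"
    unfolding char_def by (intro integral_distr) (auto intro!: borel_measurable_sum meas)
  finally show ?thesis by (simp add: mult_ac)
qed

text \<open>By Fubini, integrate out the summands first: this leaves
  \<open>char \<mu> (c * t) ^ k\<close> averaged over the law of the count, which is the generating
  function at that value.\<close>

lemma
  assumes "prob_space N" and K: "K \<in> N \<rightarrow>\<^sub>M count_space {1..}" and "real_distribution \<mu>"
  shows real_distribution_random_sum_law:
      "real_distribution (random_sum_law c (distr N (count_space {1..}) K) \<mu>)" (is ?real)
    and char_random_sum_law:
      "char (random_sum_law c (distr N (count_space {1..}) K) \<mu>) t = pgf N K (char \<mu> (c * t))" (is ?char)
proof -
  interpret N: prob_space N by fact
  interpret \<mu>: real_distribution \<mu> by fact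
  let ?\<kappa> = "distr N (count_space {1..}) K" and ?P = "\<Pi>\<^sub>M j\<in>{1::nat..}. \<mu>"
  let ?f = "\<lambda>(k::nat, x::nat \<Rightarrow> real). c * (\<Sum>j=1..k. x j)"
  interpret \<kappa>: prob_space ?\<kappa> using K by (rule N.prob_space_distr)
  interpret P': prob_space ?P by (intro prob_space_PiM) unfold_locales
  interpret pair_prob_space ?\<kappa> ?P ..
  have "sets (?\<kappa> \<Otimes>\<^sub>M ?P) = sets (count_space {1::nat..} \<Otimes>\<^sub>M (\<Pi>\<^sub>M j\<in>{1::nat..}. (borel :: real measure)))"
    by (intro sets_pair_measure_cong sets_PiM_cong) simp_all
  then have f [measurable]: "?f \<in> borel_measurable (?\<kappa> \<Otimes>\<^sub>M ?P)"
    using random_sum_measurable[of c] measurable_cong_sets by blast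
  have iexp: "(\<lambda>z. complex_of_real (t * ?f z)) \<in> borel_measurable (?\<kappa> \<Otimes>\<^sub>M ?P)"
    by (rule measurable_compose[OF f, of "\<lambda>x. complex_of_real (t * x)" borel]) simp
  show ?real unfolding random_sum_law_def using f by (rule real_distribution_distr)
  have "char (random_sum_law c ?\<kappa> \<mu>) t = (CLINT z|(?\<kappa> \<Otimes>\<^sub>M ?P). iexp (t * ?f z))"
    unfolding random_sum_law_def char_def by (intro integral_distr f) simp
  also have "\<dots> = (CLINT k|?\<kappa>. CLINT x|?P. iexp (t * ?f (k, x)))"
    by (intro integral_fst'[symmetric] integrable_iexp iexp) simp
  also have "\<dots> = (CLINT k|?\<kappa>. char \<mu> (c * t) ^ k)"
    using char_scaled_sum[OF assms(3), of t c] by simp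
  also have "\<dots> = pgf N K (char \<mu> (c * t))"
    unfolding pgf_def by (intro integral_distr K) simp
  finally show ?char .
qed

section \<open>Moments from generating functions and characteristic functions\<close>

text \<open>The quotient \<open>(1 - z^K) / (1 - z)\<close> is the geometric sum
  \<open>1 + z + ... + z^(K-1)\<close>, which increases to \<open>K\<close> as \<open>z\<close>
  increases to 1. Monotone convergence then yields integrability and the mean at once.\<close>

lemma has_mean_of_pgf:
  fixes z :: "nat \<Rightarrow> real"
  assumes "prob_space N" and K: "K \<in> N \<rightarrow>\<^sub>M count_space {1..}"
    and z: "incseq z" "z \<longlonglongrightarrow> 1" "\<And>m. 0 \<le> z m" "\<And>m. z m < 1"
    and q: "\<And>m. pgf N K (complex_of_real (z m)) = complex_of_real (q m)"
    and lim: "(\<lambda>m. (1 - q m) / (1 - z m)) \<longlonglongrightarrow> L"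
  shows "integrable N (\<lambda>\<omega>. real (K \<omega>)) \<and> (\<integral>\<omega>. real (K \<omega>) \<partial>N) = L"
proof -
  interpret prob_space N by fact
  have [measurable]: "K \<in> N \<rightarrow>\<^sub>M count_space UNIV"
    using measurable_comp[OF K measurable_count_space, of id] by (simp add: comp_def)
  have int: "integrable N (\<lambda>\<omega>. z m ^ K \<omega>)" for m
    using z(3,4)[of m] by (intro integrable_const_bound[of _ 1]) (auto simp: power_le_one)
  have pgf: "(\<integral>\<omega>. z m ^ K \<omega> \<partial>N) = q m" for m
  proof -
    have "complex_of_real (\<integral>\<omega>. z m ^ K \<omega> \<partial>N) = pgf N K (complex_of_real (z m))"
      unfolding pgf_def by (simp flip: integral_complex_of_real)
    then show ?thesis using q by simp
  qed
  define g where "g m \<omega> = (\<Sum>j<K \<omega>. z m ^ j)" for m \<omega>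
  have g: "g m \<omega> = (1 - z m ^ K \<omega>) / (1 - z m)" for m \<omega>
    unfolding g_def using z(4)[of m] by (simp add: sum_gp_strict)
  have intg: "integrable N (g m)" for m
    unfolding g using int by auto
  have "(\<integral>\<omega>. g m \<omega> \<partial>N) = (1 - q m) / (1 - z m)" for m
    unfolding g using int[of m] pgf[of m] by (simp add: prob_space)
  then have lim': "(\<lambda>m. \<integral>\<omega>. g m \<omega> \<partial>N) \<longlonglongrightarrow> L" using lim by simp
  have mono: "AE \<omega> in N. mono (\<lambda>m. g m \<omega>)"
    using z(1,3) by (auto simp: mono_def g_def intro!: sum_mono power_mono)
  have ptw: "AE \<omega> in N. (\<lambda>m. g m \<omega>) \<longlonglongrightarrow> real (K \<omega>)"
  proof (rule AE_I2)
    fix \<omega>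
    have "(\<lambda>m. \<Sum>j<K \<omega>. z m ^ j) \<longlonglongrightarrow> (\<Sum>j<K \<omega>. 1 ^ j)"
      by (intro tendsto_intros z(2))
    then show "(\<lambda>m. g m \<omega>) \<longlonglongrightarrow> real (K \<omega>)" by (simp add: g_def)
  qed
  have "(\<lambda>\<omega>. real (K \<omega>)) \<in> borel_measurable N" by simp
  from integrable_monotone_convergence[OF intg mono ptw lim' this]
    integral_monotone_convergence[OF intg mono ptw lim' this]
  show ?thesis by simp
qed

text \<open>This is Fatou's lemma: \<open>2 (1 - cos (t x)) / t\<^sup>2\<close> tends to \<open>x\<^sup>2\<close> as \<open>t\<close> tends to 0.\<close>

lemma second_moment_le_of_char:
  assumes "real_distribution M"
    and t: "t \<longlonglongrightarrow> 0" "\<And>k. t k \<noteq> 0"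
    and lim: "(\<lambda>k::nat. 2 * (1 - Re (char M (t k))) / (t k)\<^sup>2) \<longlonglongrightarrow> L"
  shows "(\<integral>\<^sup>+x. ennreal (x\<^sup>2) \<partial>M) \<le> ennreal L"
proof -
  interpret real_distribution M by fact
  \<comment> \<open>Nonnegative, as Fatou requires, and its integral involves only the real part of
    the characteristic function.\<close>
  define u where "u k x = 2 * (1 - cos (t k * x)) / (t k)\<^sup>2" for k and x :: real
  have int: "integrable M (\<lambda>x. cos (t k * x))" for k
    by (intro integrable_const_bound[of _ 1]) auto
  have "Re (char M (t k)) = (\<integral>x. cos (t k * x) \<partial>M)" for k
  proof -
    have "Re (char M (t k)) = (\<integral>x. Re (iexp (t k * x)) \<partial>M)"
      unfolding char_def by (rule integral_Re[symmetric]) (rule integrable_iexp; simp)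
    then show ?thesis by (simp add: Re_exp)
  qed
  then have "(\<integral>x. u k x \<partial>M) = 2 * (1 - Re (char M (t k))) / (t k)\<^sup>2" for k
    unfolding u_def using int[of k] prob_space by simp
  moreover have "(\<integral>\<^sup>+x. ennreal (u k x) \<partial>M) = ennreal (\<integral>x. u k x \<partial>M)" for k
    using int[of k] by (intro nn_integral_eq_integral) (auto simp: u_def)
  ultimately have "(\<lambda>k. \<integral>\<^sup>+x. ennreal (u k x) \<partial>M) \<longlonglongrightarrow> ennreal L"
    using lim by (simp add: tendsto_ennrealI)
  then have "liminf (\<lambda>k. \<integral>\<^sup>+x. ennreal (u k x) \<partial>M) = ennreal L"
    by (simp add: lim_imp_Liminf)
  moreover have "liminf (\<lambda>k. ennreal (u k x)) = ennreal (x\<^sup>2)" for x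
  proof -
    have "((\<lambda>s. 2 * (1 - cos (s * x)) / s\<^sup>2) \<longlongrightarrow> x\<^sup>2) (at 0)"
    proof (cases "x = 0")
      case False
      then show ?thesis unfolding power2_eq_square by real_asymp
    qed simp
    then have "(\<lambda>k. u k x) \<longlonglongrightarrow> x\<^sup>2"
      unfolding u_def by (rule filterlim_compose) (use t in \<open>auto simp: filterlim_at\<close>)
    then show ?thesis by (intro lim_imp_Liminf tendsto_ennrealI) simp
  qed
  ultimately show ?thesis
    using nn_integral_liminf[of "\<lambda>k x. ennreal (u k x)" M] by (simp add: u_def)
qed

section \<open>Tightness, limit laws and symmetry\<close>

lemma tight_of_second_moment_le:
  assumes M: "\<And>n. real_distribution (M n)"
    and le: "\<And>n. (\<integral>\<^sup>+x. ennreal (x\<^sup>2) \<partial>M n) \<le> ennreal C"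
  shows "tight M"
  unfolding tight_def
proof (intro conjI allI impI M)
  fix \<epsilon> :: real assume "\<epsilon> > 0"
  \<comment> \<open>The maximum with 1 keeps \<open>b\<close> positive. The choice of
    \<open>b\<close> makes the Chebyshev bound \<open>D / b^2\<close> equal to
    \<open>\<epsilon> / 4\<close>.\<close>
  define D where "D = max C 1"
  define b where "b = 2 * sqrt (D / \<epsilon>)"
  have "D > 0" "C \<le> D" by (simp_all add: D_def)
  then have b: "b > 0" "b\<^sup>2 = 4 * D / \<epsilon>" using \<open>\<epsilon> > 0\<close> by (simp_all add: b_def power_mult_distrib)
  have "measure (M n) {-b<..b} > 1 - \<epsilon>" for n
  proof -
    interpret real_distribution "M n" by (rule M)
    have "integrable (M n) (\<lambda>x. x\<^sup>2)"
      using le[of n] by (intro integrableI_bounded) (auto intro: le_less_trans)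
    then have "(\<integral>x. x\<^sup>2 \<partial>M n) \<le> D"
      using le[of n] \<open>C \<le> D\<close> \<open>D > 0\<close>
      by (subst (asm) nn_integral_eq_integral) (auto simp: ennreal_le_iff2)
    moreover have "measure (M n) {x\<in>space (M n). x\<^sup>2 \<ge> b\<^sup>2} \<le> (\<integral>x. x\<^sup>2 \<partial>M n) / b\<^sup>2"
      using \<open>integrable (M n) (\<lambda>x. x\<^sup>2)\<close> b(1) by (intro integral_Markov_inequality_measure[where A = "{}"]) auto
    ultimately have "measure (M n) {x. x\<^sup>2 \<ge> b\<^sup>2} \<le> D / b\<^sup>2"
      using b(1) by (simp add: field_simps)
    also have "\<dots> < \<epsilon>" using \<open>\<epsilon> > 0\<close> \<open>D > 0\<close> by (simp add: b(2))
    finally have "prob {x. x\<^sup>2 \<ge> b\<^sup>2} < \<epsilon>" .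
    moreover have "prob (UNIV - {-b<..b}) \<le> prob {x. x\<^sup>2 \<ge> b\<^sup>2}"
      using b(1) by (intro finite_measure_mono) (auto simp: power2_le_iff_abs_le abs_le_square_iff[symmetric])
    ultimately show ?thesis using prob_compl[of "{-b<..b}"] by simp
  qed
  then show "\<exists>a b. a < b \<and> (\<forall>n. measure (M n) {a<..b} > 1 - \<epsilon>)"
    using b(1) by (intro exI[of _ "-b"] exI[of _ b]) auto
qed

text \<open>Tightness provides a weak limit along a subsequence. This suffices: the characteristic
  functions converge along the whole sequence, so their limit must be that of the subsequential
  limit law.\<close>

lemma real_distribution_of_char_limit:
  assumes "tight M" and "\<And>t. (\<lambda>n. char (M n) t) \<longlonglongrightarrow> f t"
  obtains M' where "real_distribution M'" "char M' = f"
proof -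
  obtain r M' where r: "strict_mono (r :: nat \<Rightarrow> nat)" and M': "real_distribution M'"
    and "weak_conv_m (M \<circ> id \<circ> r) M'"
    using tight_imp_convergent_subsubsequence[OF assms(1) strict_mono_id] by blast
  then have conv: "weak_conv_m (\<lambda>n. M (r n)) M'" by (simp add: comp_def)
  have "char M' t = f t" for t
  proof (rule LIMSEQ_unique)
    show "(\<lambda>n. char (M (r n)) t) \<longlonglongrightarrow> char M' t"
      using assms(1) by (intro levy_continuity1 M' conv) (simp add: tight_def)
    show "(\<lambda>n. char (M (r n)) t) \<longlonglongrightarrow> f t"
      using LIMSEQ_subseq_LIMSEQ[OF assms(2) r] by (simp add: comp_def)
  qed
  with M' that show thesis by blast
qed

text \<open>An even characteristic function belongs to a law invariant under reflection, by
  uniqueness, so the integral equals its own negative.\<close>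

lemma mean_zero_of_char_even:
  assumes "real_distribution M" and even: "\<And>t. char M (- t) = char M t"
  shows "(\<integral>x. x \<partial>M) = 0"
proof -
  interpret real_distribution M by fact
  have "distr M borel uminus = M"
  proof (rule Levy_uniqueness)
    show "char (distr M borel uminus) = char M"
    proof
      fix t
      have "char (distr M borel uminus) t = char M (- t)"
        by (simp add: char_def integral_distr)
      then show "char (distr M borel uminus) t = char M t" by (simp add: even)
    qed
  qed (auto intro: assms)
  then have "(\<integral>x. x \<partial>M) = (\<integral>x. x \<partial>distr M borel uminus)" by simp
  also have "\<dots> = - (\<integral>x. x \<partial>M)" by (simp add: integral_distr)
  finally show ?thesis by simp
qed

section \<open>The hyperbolic secant law as a limit of random sums of signs\<close>

text \<open>A fair random sign. Transport along the identity replaces the discrete sigma-algebra by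
  the Borel one, which \<open>real_distribution\<close> demands.\<close>

definition rademacher :: "real measure" where
  "rademacher = distr (measure_pmf (pmf_of_set {-1, 1})) borel (\<lambda>x. x)"

lemma real_distribution_rademacher: "real_distribution rademacher"
  unfolding rademacher_def by (rule prob_space.real_distribution_distr[OF measure_pmf.prob_space_axioms]) simp

lemma char_rademacher: "char rademacher t = complex_of_real (cos t)"
proof -
  have "char rademacher t = (CLINT x|measure_pmf (pmf_of_set {-1, 1}). iexp (t * x))"
    by (simp add: char_def rademacher_def integral_distr)
  also have "\<dots> = (iexp (t * (-1)) + iexp t) / 2"
    by (subst integral_measure_pmf[where A = "{-1, 1}"]) (auto simp: scaleR_conv_of_real field_simps)
  also have "\<dots> = complex_of_real (cos t)"
    by (simp add: cos_exp_eq cos_of_real[symmetric])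
  finally show ?thesis .
qed

text \<open>Since \<open>cosh^2 = 1 + sinh^2\<close>, the point \<open>s = arsinh (tan x)\<close>
  has \<open>cosh s = 1 / cos x\<close>; positivity of \<open>cos x\<close> selects the correct
  square root. This places the characteristic function of a sign in the \<open>1 / cosh\<close>
  coordinate.\<close>

lemma cheb_gf_cos:
  assumes "cos x > 0"
  shows "cheb_gf n (complex_of_real (cos x)) =
    complex_of_real (1 / cosh (real n * arsinh (tan x)))"
proof -
  have "1 + (tan x)\<^sup>2 = (1 / cos x)\<^sup>2"
    using assms tan_sec[of x] by (simp add: field_simps)
  moreover have "cosh (arsinh (tan x)) = sqrt (1 + (tan x)\<^sup>2)"
    using cosh_square_eq[of "arsinh (tan x)"] cosh_real_nonneg[of "arsinh (tan x)"]
    by (metis add.commute real_sqrt_unique sinh_arsinh_real)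
  ultimately have "cosh (arsinh (tan x)) = 1 / cos x"
    using assms by (simp add: real_sqrt_unique)
  then have "cos x = 1 / cosh (arsinh (tan x))" by simp
  then show ?thesis using cheb_gf_inverse_cosh[of n "arsinh (tan x)"] by simp
qed

lemma tendsto_cheb_gf_cos:
  "(\<lambda>n. cheb_gf (Suc n) (complex_of_real (cos (c / real (Suc n))))) \<longlonglongrightarrow>
     complex_of_real (1 / cosh c)"
proof (rule Lim_transform_eventually)
  have "(\<lambda>n. c / real (Suc n)) \<longlonglongrightarrow> 0" by real_asymp
  then have "(\<lambda>n. cos (c / real (Suc n))) \<longlonglongrightarrow> cos 0"
    by (rule tendsto_cos)
  then have "\<forall>\<^sub>F n in sequentially. cos (c / real (Suc n)) > 0"
    by (rule order_tendstoD(1)) simp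
  then show "\<forall>\<^sub>F n in sequentially.
      complex_of_real (1 / cosh (real (Suc n) * arsinh (tan (c / real (Suc n))))) =
      cheb_gf (Suc n) (complex_of_real (cos (c / real (Suc n))))"
    by eventually_elim (simp only: cheb_gf_cos)
  \<comment> \<open>Near 0, \<open>arsinh (tan x)\<close> is asymptotic to \<open>x\<close>, so
    multiplication by the index recovers \<open>c\<close>. The case \<open>c = 0\<close> is separate
    because the argument divides by \<open>c / real (Suc n)\<close>.\<close>
  have "(\<lambda>n. real (Suc n) * arsinh (tan (c / real (Suc n)))) \<longlonglongrightarrow> c"
  proof (cases "c = 0")
    case False
    have "((\<lambda>x::real. arsinh (tan x) / x) \<longlongrightarrow> 1) (at 0)" by real_asymp
    then have "(\<lambda>n. arsinh (tan (c / real (Suc n))) / (c / real (Suc n))) \<longlonglongrightarrow> 1"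
      by (rule filterlim_compose)
        (use \<open>(\<lambda>n. c / real (Suc n)) \<longlonglongrightarrow> 0\<close> False in \<open>auto simp: filterlim_at\<close>)
    then have "(\<lambda>n. c * (arsinh (tan (c / real (Suc n))) / (c / real (Suc n)))) \<longlonglongrightarrow> c * 1"
      by (intro tendsto_intros)
    then show ?thesis using False by (simp add: mult.commute)
  qed simp
  then show "(\<lambda>n. complex_of_real (1 / cosh (real (Suc n) * arsinh (tan (c / real (Suc n)))))) \<longlonglongrightarrow>
      complex_of_real (1 / cosh c)"
    by (intro tendsto_of_real tendsto_divide tendsto_const tendsto_cosh) simp_all
qed

lemma ex_sech_distribution:
  assumes prob: "\<And>n. n \<ge> 1 \<Longrightarrow> prob_space (Q n)"
    and K: "\<And>n. n \<ge> 1 \<Longrightarrow> K n \<in> Q n \<rightarrow>\<^sub>M count_space {1..}"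
    and gf: "\<And>n z. n \<ge> 1 \<Longrightarrow> norm z \<le> 1 \<Longrightarrow> pgf (Q n) (K n) z = cheb_gf n z"
    and a: "a > 0"
  obtains M where "real_distribution M" "char M = (\<lambda>t. complex_of_real (1 / cosh (a * t)))"
proof -
  define X where "X n = random_sum_law (a / real (Suc n))
    (distr (Q (Suc n)) (count_space {1..}) (K (Suc n))) rademacher" for n
  have X: "real_distribution (X n)" for n
    unfolding X_def
    by (rule real_distribution_random_sum_law[OF prob K real_distribution_rademacher]) simp_all
  have char_X: "char (X n) t = cheb_gf (Suc n) (complex_of_real (cos (a * t / real (Suc n))))" for n t
    unfolding X_def
    by (subst char_random_sum_law[OF prob K real_distribution_rademacher])
      (simp_all add: gf char_rademacher del: One_nat_def)
  have "tight X"
  proof (rule tight_of_second_moment_le[OF X])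
    fix n
    define N where "N = real (Suc n)"
    \<comment> \<open>Chosen so that
      \<open>cos (a * \<tau> k / N) = 1 / cosh (1 / real (Suc k))\<close>, which makes the
      characteristic function of \<open>X n\<close> at \<open>\<tau> k\<close> explicit. The
      resulting bound \<open>a^2\<close> is independent of \<open>n\<close>, as tightness
      needs.\<close>
    define \<tau> where "\<tau> k = N / a * arctan (sinh (1 / real (Suc k)))" for k :: nat
    have N: "N > 0" by (simp add: N_def)
    have "char (X n) (\<tau> k) = complex_of_real (1 / cosh (N / real (Suc k)))" for k
    proof -
      have "1 + (sinh (1 / real (Suc k)))\<^sup>2 = (cosh (1 / real (Suc k)))\<^sup>2"
        by (simp add: cosh_square_eq)
      then have "cos (arctan (sinh (1 / real (Suc k)))) = 1 / cosh (1 / real (Suc k))"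
        by (simp add: cos_arctan)
      moreover have "a * \<tau> k / real (Suc n) = arctan (sinh (1 / real (Suc k)))"
        using a by (simp add: \<tau>_def N_def del: of_nat_Suc)
      ultimately show ?thesis
        unfolding char_X using cheb_gf_inverse_cosh[of "Suc n" "1 / real (Suc k)"]
        by (simp add: N_def)
    qed
    then have "2 * (1 - Re (char (X n) (\<tau> k))) / (\<tau> k)\<^sup>2 =
        2 * (1 - 1 / cosh (N / real (Suc k))) / (N / a * arctan (sinh (1 / real (Suc k))))\<^sup>2" for k
      by (simp add: \<tau>_def)
    moreover have "(\<lambda>k::nat. 2 * (1 - 1 / cosh (N / real (Suc k))) /
        (N / a * arctan (sinh (1 / real (Suc k))))\<^sup>2) \<longlonglongrightarrow> a\<^sup>2"
      using a N by real_asymp (simp add: field_simps power2_eq_square)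
    ultimately have "(\<lambda>k. 2 * (1 - Re (char (X n) (\<tau> k))) / (\<tau> k)\<^sup>2) \<longlonglongrightarrow> a\<^sup>2" by simp
    moreover have "\<tau> \<longlonglongrightarrow> 0" unfolding \<tau>_def using a N by real_asymp
    moreover have "\<tau> k \<noteq> 0" for k using a N by (simp add: \<tau>_def)
    ultimately show "(\<integral>\<^sup>+x. ennreal (x\<^sup>2) \<partial>X n) \<le> ennreal (a\<^sup>2)"
      by (intro second_moment_le_of_char[OF X])
  qed
  moreover have "(\<lambda>n. char (X n) t) \<longlonglongrightarrow> complex_of_real (1 / cosh (a * t))" for t
    unfolding char_X by (rule tendsto_cheb_gf_cos)
  ultimately show thesis
    using that by (rule real_distribution_of_char_limit)
qed

text \<open>The expansion \<open>1 - 1 / cosh (a * t) ~ a^2 * t^2 / 2\<close> at 0 bounds the second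
  moment by \<open>a^2\<close>. Square integrability gives integrability, and evenness of
  \<open>cosh\<close> gives mean 0.\<close>

lemma
  assumes "real_distribution M" and char: "\<And>t. char M t = complex_of_real (1 / cosh (a * t))"
    and "a > 0"
  shows integrable_square_sech: "integrable M (\<lambda>x. x\<^sup>2)" (is ?sq)
    and integrable_sech: "integrable M (\<lambda>x. x)"
    and mean_sech: "(\<integral>x. x \<partial>M) = 0"
proof -
  interpret real_distribution M by fact
  have "(\<lambda>k. 2 * (1 - Re (char M (1 / real (Suc k)))) / (1 / real (Suc k))\<^sup>2) =
      (\<lambda>k. 2 * (1 - 1 / cosh (a / real (Suc k))) / (1 / real (Suc k))\<^sup>2)"
    by (simp only: char Re_complex_of_real mult_1_right times_divide_eq_right)
  also have "\<dots> \<longlonglongrightarrow> a\<^sup>2"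
    using \<open>a > 0\<close> by real_asymp (simp add: field_simps power2_eq_square)
  finally have "(\<lambda>k. 2 * (1 - Re (char M (1 / real (Suc k)))) / (1 / real (Suc k))\<^sup>2) \<longlonglongrightarrow> a\<^sup>2" .
  then have "(\<integral>\<^sup>+x. ennreal (x\<^sup>2) \<partial>M) \<le> ennreal (a\<^sup>2)"
    by (rule second_moment_le_of_char[OF assms(1), rotated 2]) (real_asymp, simp)
  then have "(\<integral>\<^sup>+x. ennreal (x\<^sup>2) \<partial>M) < \<infinity>"
    by (rule le_less_trans) simp
  then show ?sq
    by (intro integrableI_bounded) simp_all
  then show "integrable M (\<lambda>x. x)"
    by (rule square_integrable_imp_integrable[rotated]) simp
  show "(\<integral>x. x \<partial>M) = 0"
    by (rule mean_zero_of_char_even[OF assms(1)]) (simp add: char)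
qed

section \<open>Composition on the closed disc and assembly of the three claims\<close>

text \<open>Keeps iterated generating functions inside the closed disc, where their identification
  with \<open>cheb_gf\<close> is available.\<close>

lemma norm_pgf_le_1:
  assumes "prob_space N" and "norm z \<le> 1"
  shows "norm (pgf N K z) \<le> 1"
proof -
  interpret prob_space N by fact
  have "norm (pgf N K z) \<le> (\<integral>\<omega>. norm (z ^ K \<omega>) \<partial>N)"
    unfolding pgf_def by (rule integral_norm_bound)
  also have "\<dots> \<le> (\<integral>\<omega>. 1 \<partial>N)"
    using assms(2) by (intro integral_mono') (auto simp: norm_power power_le_one)
  finally show ?thesis by (simp add: prob_space)
qed

text \<open>Indices multiply under composition, so on the closed disc commutativity of the semigroup
  reduces to that of multiplication in the naturals.\<close>

lemma comp_semigroup_cheb_gf: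
  assumes "F \<in> comp_semigroup S"
    and S: "\<And>G. G \<in> S \<Longrightarrow> \<exists>n\<ge>1. \<forall>z. norm z \<le> 1 \<longrightarrow> G z = cheb_gf n z"
    and le: "\<And>n z. n \<ge> 1 \<Longrightarrow> norm z \<le> 1 \<Longrightarrow> norm (cheb_gf n z) \<le> 1"
  shows "\<exists>n\<ge>1. \<forall>z. norm z \<le> 1 \<longrightarrow> F z = cheb_gf n z"
  using assms(1)
proof induction
  case (gen F)
  then show ?case by (rule S)
next
  case (comp F G)
  then obtain m n where "m \<ge> 1" "\<And>z. norm z \<le> 1 \<Longrightarrow> F z = cheb_gf m z"
    and "n \<ge> 1" "\<And>z. norm z \<le> 1 \<Longrightarrow> G z = cheb_gf n z" by auto
  then show ?case
    by (intro exI[of _ "m * n"]) (simp add: le cheb_gf_comp)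
qed

theorem mainTheorem1:
  fixes \<Delta> :: "real set"
    and N :: "real \<Rightarrow> 'a measure"
    and \<nu> :: "real \<Rightarrow> 'a \<Rightarrow> nat"
    and \<P> :: "real \<Rightarrow> complex \<Rightarrow> complex"
    and \<phi> :: "real \<Rightarrow> real"
  assumes Delta: "\<Delta> = {1 / (real n)\<^sup>2 | n :: nat. n \<ge> 1}"
    and prob: "\<And>p. p \<in> \<Delta> \<Longrightarrow> prob_space (N p)"
    and rv: "\<And>p. p \<in> \<Delta> \<Longrightarrow> \<nu> p \<in> N p \<rightarrow>\<^sub>M count_space {1..}"
    and P: "\<And>p. \<P> p = pgf (N p) (\<nu> p)"
    and gf: "\<And>p n z. p \<in> \<Delta> \<Longrightarrow> real n = 1 / sqrt p \<Longrightarrow> norm z \<le> 1 \<Longrightarrow> \<P> p z = cheb_gf n z"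
    and phi: "\<And>t. \<phi> t = 1 / cosh (sqrt (2 * t))"
  shows
    "((\<forall>p1\<in>\<Delta>. \<forall>p2\<in>\<Delta>. \<forall>z. norm z \<le> 1 \<longrightarrow> \<P> p1 (\<P> p2 z) = \<P> p2 (\<P> p1 z)) \<and>
      (\<forall>F\<in>comp_semigroup (\<P> ` \<Delta>). \<forall>G\<in>comp_semigroup (\<P> ` \<Delta>).
         \<forall>z. norm z \<le> 1 \<longrightarrow> F (G z) = G (F z))) \<and>
     ((\<forall>p\<in>\<Delta>. \<forall>t\<ge>0. complex_of_real (\<phi> t) = \<P> p (complex_of_real (\<phi> (p * t)))) \<and>
      \<phi> 0 = 1 \<and> (\<phi> has_real_derivative -1) (at_right 0)) \<and>
     (\<forall>a>0. \<exists>(M :: real measure) X. strictly_nu_normal \<Delta> N \<nu> M X \<and>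
        (\<forall>t. char (distr M borel X) t = complex_of_real (1 / cosh (a * t))))"
proof -
  have Delta_iff: "p \<in> \<Delta> \<longleftrightarrow> (\<exists>n\<ge>1. p = 1 / (real n)\<^sup>2)" for p
    by (auto simp: Delta)
  have P_eq: "\<P> (1 / (real n)\<^sup>2) z = cheb_gf n z" if "n \<ge> 1" "norm z \<le> 1" for n z
    by (rule gf) (use that in \<open>auto simp: Delta_iff real_sqrt_divide\<close>)
  \<comment> \<open>The bound comes from probability: \<open>cheb_gf n\<close> agrees on the closed
    disc with the generating function of an actual random variable.\<close>
  have le: "norm (cheb_gf n z) \<le> 1" if "n \<ge> 1" "norm z \<le> 1" for n z
    using norm_pgf_le_1[OF prob that(2)] P_eq[OF that] that(1)
    by (metis Delta_iff P)

  have gen: "\<exists>n\<ge>1. \<forall>z. norm z \<le> 1 \<longrightarrow> F z = cheb_gf n z" if F: "F \<in> \<P> ` \<Delta>" for F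
  proof -
    obtain p where "p \<in> \<Delta>" "F = \<P> p" using F by blast
    moreover from this(1) obtain n where "n \<ge> 1" "p = 1 / (real n)\<^sup>2"
      using Delta_iff[of p] by blast
    ultimately show ?thesis using P_eq[of n] by (intro exI[of _ n]) simp
  qed
  have commute: "F (G z) = G (F z)"
    if F: "F \<in> comp_semigroup (\<P> ` \<Delta>)" and G: "G \<in> comp_semigroup (\<P> ` \<Delta>)"
      and z: "norm z \<le> 1" for F G z
  proof -
    obtain m n where mn: "m \<ge> 1" "n \<ge> 1"
      and "\<And>w. norm w \<le> 1 \<Longrightarrow> F w = cheb_gf m w" "\<And>w. norm w \<le> 1 \<Longrightarrow> G w = cheb_gf n w"
      using comp_semigroup_cheb_gf[OF F gen le] comp_semigroup_cheb_gf[OF G gen le] by blast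
    then show ?thesis
      using z by (simp add: le cheb_gf_comp mult.commute)
  qed

  have scaling: "complex_of_real (\<phi> t) = \<P> p (complex_of_real (\<phi> (p * t)))" if p_in: "p \<in> \<Delta>" for p t
  proof -
    obtain n where n: "n \<ge> 1" and p: "p = 1 / (real n)\<^sup>2" using p_in Delta_iff by auto
    \<comment> \<open>In the coordinate \<open>s = sqrt (2 * t)\<close>, scaling time by
      \<open>p\<close> divides \<open>s\<close> by \<open>n\<close>, and \<open>cheb_gf n\<close>
      multiplies it back.\<close>
    have "sqrt (2 * (p * t)) = sqrt (2 * t) / real n"
      by (simp add: p real_sqrt_divide)
    then have "\<phi> (p * t) = 1 / cosh (sqrt (2 * t) / real n)" by (simp only: phi)
    moreover have "\<P> p (complex_of_real (1 / cosh (sqrt (2 * t) / real n))) =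
        cheb_gf n (complex_of_real (1 / cosh (sqrt (2 * t) / real n)))"
      unfolding p using n by (intro P_eq) (auto simp: norm_divide cosh_real_ge_1)
    ultimately have "\<P> p (complex_of_real (\<phi> (p * t))) =
        complex_of_real (1 / cosh (real n * (sqrt (2 * t) / real n)))"
      by (simp only: cheb_gf_inverse_cosh)
    then show ?thesis using n by (simp add: phi[of t])
  qed
  have "((\<lambda>t::real. (1 / cosh (sqrt (2 * t)) - 1) / t) \<longlongrightarrow> -1) (at_right 0)"
    by real_asymp (simp add: powr_add [symmetric])
  then have deriv: "(\<phi> has_real_derivative -1) (at_right 0)"
    by (simp add: has_field_derivative_iff phi)

  have family: "nu_family \<Delta> N \<nu>"
    unfolding nu_family_def
  proof (intro ballI)
    fix p assume p: "p \<in> \<Delta>"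
    then obtain n where n: "n \<ge> 1" and p_eq: "p = 1 / (real n)\<^sup>2" using Delta_iff by auto
    have "integrable (N p) (\<lambda>\<omega>. real (\<nu> p \<omega>)) \<and> (\<integral>\<omega>. real (\<nu> p \<omega>) \<partial>N p) = (real n)\<^sup>2"
    proof (rule has_mean_of_pgf[OF prob[OF p] rv[OF p]])
      \<comment> \<open>The points \<open>1 / cosh (1 / real (Suc m))\<close> increase to 1, and the
        generating function is explicit at each of them.\<close>
      show "incseq (\<lambda>m. 1 / cosh (1 / real (Suc m)))"
        by (auto simp: incseq_def intro!: divide_left_mono simp: cosh_real_nonneg_le_iff field_simps)
      show "(\<lambda>m. 1 / cosh (1 / real (Suc m))) \<longlonglongrightarrow> 1" by real_asymp
      show "0 \<le> 1 / cosh (1 / real (Suc m))" "1 / cosh (1 / real (Suc m)) < 1" for m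
        using cosh_real_strict_mono[of 0 "1 / real (Suc m)"] by simp_all
      have "pgf (N p) (\<nu> p) (complex_of_real (1 / cosh (1 / real (Suc m)))) =
          cheb_gf n (complex_of_real (1 / cosh (1 / real (Suc m))))" for m
        using P_eq[OF n, of "complex_of_real (1 / cosh (1 / real (Suc m)))"]
        by (simp add: P p_eq norm_divide cosh_real_ge_1)
      then show "pgf (N p) (\<nu> p) (complex_of_real (1 / cosh (1 / real (Suc m)))) =
          complex_of_real (1 / cosh (real n / real (Suc m)))" for m
        unfolding cheb_gf_inverse_cosh by simp
      \<comment> \<open>Both numerator and denominator are quadratic to leading order, so the ratio
        tends to \<open>r^2\<close>; naming \<open>r\<close> lets \<open>real_asymp\<close> treat it
        as a real parameter.\<close>
      define r where "r = real n"
      have "r > 0" using n by (simp add: r_def)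
      then have "(\<lambda>m. (1 - 1 / cosh (r / real (Suc m))) / (1 - 1 / cosh (1 / real (Suc m)))) \<longlonglongrightarrow> r\<^sup>2"
        by real_asymp (simp add: power2_eq_square)
      then show "(\<lambda>m. (1 - 1 / cosh (real n / real (Suc m))) / (1 - 1 / cosh (1 / real (Suc m))))
          \<longlonglongrightarrow> (real n)\<^sup>2" by (simp add: r_def)
    qed
    then show "prob_space (N p) \<and> \<nu> p \<in> N p \<rightarrow>\<^sub>M count_space {1..} \<and>
        integrable (N p) (\<lambda>\<omega>. real (\<nu> p \<omega>)) \<and> (\<integral>\<omega>. real (\<nu> p \<omega>) \<partial>N p) = 1 / p"
      using prob[OF p] rv[OF p] by (simp add: p_eq)
  qed

  have normal: "\<exists>(M :: real measure) X. strictly_nu_normal \<Delta> N \<nu> M X \<and>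
      (\<forall>t. char (distr M borel X) t = complex_of_real (1 / cosh (a * t)))" if a: "a > 0" for a
  proof -
    obtain M where M: "real_distribution M"
      and char_M: "char M = (\<lambda>t. complex_of_real (1 / cosh (a * t)))"
    proof (rule ex_sech_distribution[OF _ _ _ a])
      show "prob_space (N (1 / (real n)\<^sup>2))"
        "\<nu> (1 / (real n)\<^sup>2) \<in> N (1 / (real n)\<^sup>2) \<rightarrow>\<^sub>M count_space {1..}" if "n \<ge> 1" for n
        by (rule prob rv, use that Delta_iff in blast)+
      show "pgf (N (1 / (real n)\<^sup>2)) (\<nu> (1 / (real n)\<^sup>2)) z = cheb_gf n z"
        if "n \<ge> 1" "norm z \<le> 1" for n z
        using P_eq[OF that] by (simp add: P)
    qed
    interpret M: real_distribution M by fact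
    have distr_M: "distr M borel (\<lambda>x. x) = M" by (rule distr_id2) simp
    have fixed_point: "M = random_sum_law (p powr (1/2)) (distr (N p) (count_space {1..}) (\<nu> p)) M"
      if p: "p \<in> \<Delta>" for p
    proof (rule Levy_uniqueness[OF M])
      show "real_distribution (random_sum_law (p powr (1/2)) (distr (N p) (count_space {1..}) (\<nu> p)) M)"
        by (rule real_distribution_random_sum_law[OF prob[OF p] rv[OF p] M])
      obtain n where n: "n \<ge> 1" and p_eq: "p = 1 / (real n)\<^sup>2" using p Delta_iff by auto
      have c: "p powr (1/2) = 1 / real n"
        by (simp add: p_eq powr_half_sqrt real_sqrt_divide)
      \<comment> \<open>The normalisation \<open>p powr (1/2) = 1 / real n\<close> divides the
        argument of \<open>cosh\<close> by exactly the factor that the generating function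
        restores.\<close>
      have "pgf (N p) (\<nu> p) (char M (1 / real n * t)) = char M t" for t
      proof -
        have "pgf (N p) (\<nu> p) (char M (1 / real n * t)) =
            cheb_gf n (complex_of_real (1 / cosh (a * (1 / real n * t))))"
          using P_eq[OF n M.cmod_char_le_1[of "1 / real n * t"]] by (simp add: P p_eq char_M)
        then show ?thesis unfolding cheb_gf_inverse_cosh using n by (simp add: char_M)
      qed
      then show "char M = char (random_sum_law (p powr (1/2)) (distr (N p) (count_space {1..}) (\<nu> p)) M)"
        by (intro ext) (simp only: char_random_sum_law[OF prob[OF p] rv[OF p] M] c)
    qed
    have "strictly_nu_normal \<Delta> N \<nu> M (\<lambda>x. x)"
      unfolding strictly_nu_normal_def distr_M
    proof (intro conjI ballI)
      show "integrable M (\<lambda>x. x)" "(\<integral>x. x \<partial>M) = 0" "integrable M (\<lambda>x. x\<^sup>2)"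
        by (rule integrable_sech[OF M _ a] mean_sech[OF M _ a] integrable_square_sech[OF M _ a],
            simp only: char_M)+
    qed (rule family fixed_point M.prob_space_axioms | simp)+
    then show ?thesis by (intro exI[of _ M] exI[of _ "\<lambda>x. x"]) (simp only: distr_M char_M simp_thms)
  qed

  show ?thesis
  proof (intro conjI ballI allI impI)
    show "\<P> p1 (\<P> p2 z) = \<P> p2 (\<P> p1 z)" if "p1 \<in> \<Delta>" "p2 \<in> \<Delta>" "norm z \<le> 1" for p1 p2 z
      using that by (intro commute comp_semigroup.gen) auto
    show "\<phi> 0 = 1" by (simp add: phi)
  qed (rule commute scaling deriv normal; assumption)+
qed

end
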